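(* Let $\mathbf{C}=\{0,1\}^\omega$ be the Cantor set. There exists a continuous open retraction $r: B_z^1(\mathbf{C})\to\mathbf{C}$ such that for any $X\subset\mathbf{C}$, putting $S=B_z^1(\mathbf{C}|X)$, the map $r|_S: S\to X$ is a continuous open retraction. The set $B_z^1(\mathbf{C})$ is a clopen subset of $B_z(\mathbf{C})$, which is a precompact separable metrizable zero-dimensional topological group. Moreover, let $X\subset\mathbf{C}$, $y\in X$ and $$h_y: B_z^1(\mathbf{C})\to B_z^0(\mathbf{C}),\quad g\mapsto g+\{y\}.$$ Then $h_y$ is a homeomorphism and $h_y(B_z^1(\mathbf{C}|X))=B_z^0(\mathbf{C}|X)$; consequently $X$ (embedded by $x\mapsto h_y(\{x\})$) is an open continuous retract of the precompact Boolean separable metrizable zero-dimensional group $B_z^0(\mathbf{C}|X)$.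
   Context: For a zero-dimensional space $Z$, $B(Z)$ denotes the set of all finite subsets of $Z$, regarded as an additive Boolean group (every element satisfies $g+g=0$) with zero $\varnothing$ and addition given by symmetric difference. $\Gamma(Z)$ is the family of all partitions of $Z$ into open sets. For $\gamma\in\Gamma(Z)$ put $H(\gamma)=\{g\in B(Z): |g\cap U| \text{ is even for all } U\in\gamma\}$. $B_z(Z)$ is the group $B(Z)$ with the group topology for which the sets $H(\gamma)$, $\gamma\in\Gamma(Z)$, form a subbase of neighbourhoods at the zero element. $Z$ is identified with its image under the embedding $Z\to B_z(Z)$, $x\mapsto\{x\}$; a retraction of a subset of $B_z(Z)$ containing these points onto a subset of $Z$ is understood with respect to this identification. Put $B_z^0(Z)=\{g\in B_z(Z): |g|\text{ is even}\}$, $B_z^1(Z)=\{g\in B_z(Z): |g|\text{ is odd}\}$, and for $Y\subset Z$ and $i\in\{0,1\}$ put $B_z^i(Z|Y)=\{g\in B_z^i(Z): g\subset Y\}$, all with the subspace topology (so $B_z^0(Z|Y)$ is a subgroup of $B_z(Z)$). A topological group is precompact if for each neighbourhood $U$ of the identity finitely many translates of $U$ cover the group. An "open continuous retract" means the image of a retraction that is continuous and open as a map onto the retract. *)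

theory Defs
  imports "HOL-Analysis.Analysis" "HOL-Algebra.Coset" "HOL-Library.Disjoint_Sets"
begin

definition nbhd_in :: "'a topology \<Rightarrow> 'a \<Rightarrow> 'a set \<Rightarrow> bool" where
  "nbhd_in T x U \<longleftrightarrow> U \<subseteq> topspace T \<and> (\<exists>V. openin T V \<and> x \<in> V \<and> V \<subseteq> U)"

definition topological_group :: "('a, 'm) monoid_scheme \<Rightarrow> 'a topology \<Rightarrow> bool" where
  "topological_group G T \<longleftrightarrow> group G \<and> topspace T = carrier G \<and>
     continuous_map (prod_topology T T) T (\<lambda>(x, y). x \<otimes>\<^bsub>G\<^esub> y) \<and>
     continuous_map T T (\<lambda>x. inv\<^bsub>G\<^esub> x)"

definition precompact_group :: "('a, 'm) monoid_scheme \<Rightarrow> 'a topology \<Rightarrow> bool" where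
  "precompact_group G T \<longleftrightarrow> topological_group G T \<and>
     (\<forall>U. nbhd_in T \<one>\<^bsub>G\<^esub> U \<longrightarrow>
        (\<exists>F. finite F \<and> F \<subseteq> carrier G \<and> carrier G \<subseteq> (\<Union>a\<in>F. a <#\<^bsub>G\<^esub> U)))"

definition boolean_group :: "('a, 'm) monoid_scheme \<Rightarrow> bool" where
  "boolean_group G \<longleftrightarrow> group G \<and> (\<forall>g\<in>carrier G. g \<otimes>\<^bsub>G\<^esub> g = \<one>\<^bsub>G\<^esub>)"

text \<open>Here \<open>Y\<close> is identified with its image in \<open>T\<close> under \<open>e\<close>; by \<open>retraction_maps\<close>,
  \<open>e\<close> is continuous with continuous left inverse \<open>r\<close>, hence an embedding.\<close>

definition open_retraction_maps ::
  "'a topology \<Rightarrow> 'b topology \<Rightarrow> ('a \<Rightarrow> 'b) \<Rightarrow> ('b \<Rightarrow> 'a) \<Rightarrow> bool" where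
  "open_retraction_maps T Y r e \<longleftrightarrow> retraction_maps T Y r e \<and> open_map T Y r"

definition open_continuous_retract :: "'a set \<Rightarrow> 'a topology \<Rightarrow> bool" where
  "open_continuous_retract A T \<longleftrightarrow> A \<subseteq> topspace T \<and>
     (\<exists>r. continuous_map T (subtopology T A) r \<and> open_map T (subtopology T A) r \<and>
          (\<forall>a\<in>A. r a = a))"

definition B_group :: "'a topology \<Rightarrow> 'a set monoid" where
  "B_group Z = \<lparr>carrier = {g. finite g \<and> g \<subseteq> topspace Z}, mult = sym_diff, one = {}\<rparr>"

definition open_partitions :: "'a topology \<Rightarrow> 'a set set set" where
  "open_partitions Z = {\<gamma>. partition_on (topspace Z) \<gamma> \<and> (\<forall>U\<in>\<gamma>. openin Z U)}"

definition H_set :: "'a topology \<Rightarrow> 'a set set \<Rightarrow> 'a set set" where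
  "H_set Z \<gamma> = {g \<in> carrier (B_group Z). \<forall>U\<in>\<gamma>. even (card (g \<inter> U))}"

text \<open>The basic neighbourhoods of \<open>g\<close> are the translates by \<open>g\<close> of the finite intersections of
  sets \<open>H_set Z \<gamma>\<close>. The theorems \<open>Bz_topological_group\<close>, \<open>Bz_nbhd_zero\<close> and \<open>Bz_unique\<close> below say
  that this is the one and only group topology for which the sets \<open>H_set Z \<gamma>\<close> form a subbase of
  neighbourhoods at zero.\<close>

definition Bz :: "'a topology \<Rightarrow> 'a set topology" where
  "Bz Z = topology (\<lambda>U. U \<subseteq> carrier (B_group Z) \<and>
     (\<forall>g\<in>U. \<exists>F. finite F \<and> F \<subseteq> open_partitions Z \<and>
        (\<forall>h\<in>carrier (B_group Z). (\<forall>\<gamma>\<in>F. h \<in> H_set Z \<gamma>) \<longrightarrow> g \<otimes>\<^bsub>B_group Z\<^esub> h \<in> U)))"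

text \<open>For \<open>i \<in> {0, 1}\<close>, \<open>B_parity i Z\<close> is $B_z^i(Z)$ and \<open>B_parity_on i Z Y\<close> is $B_z^i(Z|Y)$.\<close>

definition B_parity :: "nat \<Rightarrow> 'a topology \<Rightarrow> 'a set set" where
  "B_parity i Z = {g \<in> carrier (B_group Z). card g mod 2 = i}"

definition B_parity_on :: "nat \<Rightarrow> 'a topology \<Rightarrow> 'a set \<Rightarrow> 'a set set" where
  "B_parity_on i Z Y = {g \<in> B_parity i Z. g \<subseteq> Y}"

definition cantor :: "(nat \<Rightarrow> bool) topology" where
  "cantor = product_topology (\<lambda>_. discrete_topology UNIV) UNIV"

lemma carrier_B [simp]: "carrier (B_group Z) = {g. finite g \<and> g \<subseteq> topspace Z}"
  and mult_B [simp]: "g \<otimes>\<^bsub>B_group Z\<^esub> h = sym_diff g h"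
  and one_B [simp]: "\<one>\<^bsub>B_group Z\<^esub> = {}"
  by (simp_all add: B_group_def)

lemma sym_diff_assoc: "sym_diff (sym_diff a b) c = sym_diff a (sym_diff b c)"
  by blast

lemma group_B: "group (B_group Z)"
proof (rule groupI)
  fix x assume "x \<in> carrier (B_group Z)"
  then show "\<exists>y\<in>carrier (B_group Z). y \<otimes>\<^bsub>B_group Z\<^esub> x = \<one>\<^bsub>B_group Z\<^esub>"
    by (intro bexI[of _ x]) auto
next
  fix x y z
  show "x \<otimes>\<^bsub>B_group Z\<^esub> y \<otimes>\<^bsub>B_group Z\<^esub> z = x \<otimes>\<^bsub>B_group Z\<^esub> (y \<otimes>\<^bsub>B_group Z\<^esub> z)"
    unfolding mult_B by (rule sym_diff_assoc)
qed auto

lemma inv_B: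
  assumes "g \<in> carrier (B_group Z)"
  shows "inv\<^bsub>B_group Z\<^esub> g = g"
proof -
  interpret group "B_group Z" by (rule group_B)
  have "g \<otimes>\<^bsub>B_group Z\<^esub> g = \<one>\<^bsub>B_group Z\<^esub>" by simp
  then show ?thesis using assms inv_equality by blast
qed

lemma even_card_sym_diff:
  assumes "finite a" "finite b"
  shows "even (card (sym_diff a b)) \<longleftrightarrow> (even (card a) \<longleftrightarrow> even (card b))"
proof -
  have "card (sym_diff a b) = card (a - b) + card (b - a)"
    using assms by (intro card_Un_disjoint) auto
  moreover have "card a = card (a - b) + card (a \<inter> b)"
    using assms(1) card_Diff_subset_Int[of a b] card_mono[of a "a \<inter> b"] by simp
  moreover have "card b = card (b - a) + card (a \<inter> b)"
    using assms card_Diff_subset_Int[of b a] card_mono[of b "b \<inter> a"] by (simp add: Int_commute)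
  ultimately show ?thesis by presburger
qed

lemma H_set_sym_diff:
  assumes "g \<in> H_set Z \<gamma>" "h \<in> H_set Z \<gamma>"
  shows "sym_diff g h \<in> H_set Z \<gamma>"
proof -
  have "even (card (sym_diff g h \<inter> U))" if "U \<in> \<gamma>" for U
  proof -
    have "sym_diff g h \<inter> U = sym_diff (g \<inter> U) (h \<inter> U)" by blast
    then show ?thesis
      using assms that even_card_sym_diff[of "g \<inter> U" "h \<inter> U"] by (simp add: H_set_def)
  qed
  then show ?thesis using assms by (auto simp: H_set_def)
qed

lemma openin_Bz:
  "openin (Bz Z) U \<longleftrightarrow> U \<subseteq> carrier (B_group Z) \<and>
     (\<forall>g\<in>U. \<exists>F. finite F \<and> F \<subseteq> open_partitions Z \<and>
        (\<forall>h\<in>carrier (B_group Z). (\<forall>\<gamma>\<in>F. h \<in> H_set Z \<gamma>) \<longrightarrow> g \<otimes>\<^bsub>B_group Z\<^esub> h \<in> U))"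
proof -
  define P where "P U g F \<longleftrightarrow> finite F \<and> F \<subseteq> open_partitions Z \<and>
    (\<forall>h\<in>carrier (B_group Z). (\<forall>\<gamma>\<in>F. h \<in> H_set Z \<gamma>) \<longrightarrow> g \<otimes>\<^bsub>B_group Z\<^esub> h \<in> U)" for U g F
  have P_mono: "P V g F" if "P U g F" "U \<subseteq> V" for U V g F
    using that unfolding P_def by blast
  have P_Int: "P (U \<inter> V) g (F \<union> F')" if "P U g F" "P V g F'" for U V g F F'
    using that unfolding P_def by blast
  have "istopology (\<lambda>U. U \<subseteq> carrier (B_group Z) \<and> (\<forall>g\<in>U. \<exists>F. P U g F))"
    unfolding istopology_def
  proof (rule conjI; intro allI impI)
    fix S T
    assume "S \<subseteq> carrier (B_group Z) \<and> (\<forall>g\<in>S. \<exists>F. P S g F)"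
      and "T \<subseteq> carrier (B_group Z) \<and> (\<forall>g\<in>T. \<exists>F. P T g F)"
    then show "S \<inter> T \<subseteq> carrier (B_group Z) \<and> (\<forall>g\<in>S \<inter> T. \<exists>F. P (S \<inter> T) g F)"
      using P_Int by blast
  next
    fix K
    assume "\<forall>S\<in>K. S \<subseteq> carrier (B_group Z) \<and> (\<forall>g\<in>S. \<exists>F. P S g F)"
    then show "\<Union>K \<subseteq> carrier (B_group Z) \<and> (\<forall>g\<in>\<Union>K. \<exists>F. P (\<Union>K) g F)"
      using P_mono by (meson Sup_least UnionE Union_upper)
  qed
  then show ?thesis
    unfolding Bz_def P_def by (rule fun_cong[OF topology_inverse'])
qed

lemma topspace_Bz [simp]: "topspace (Bz Z) = carrier (B_group Z)"
proof
  show "topspace (Bz Z) \<subseteq> carrier (B_group Z)"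
    using openin_Bz[of Z "topspace (Bz Z)"] by blast
  have "openin (Bz Z) (carrier (B_group Z))"
    unfolding openin_Bz by (auto intro!: exI[of _ "{}"])
  then show "carrier (B_group Z) \<subseteq> topspace (Bz Z)" by (rule openin_subset)
qed

lemma openin_Bz_translate:
  assumes "g \<in> carrier (B_group Z)" "finite F" "F \<subseteq> open_partitions Z"
  shows "openin (Bz Z) {sym_diff g h |h. h \<in> carrier (B_group Z) \<and> (\<forall>\<gamma>\<in>F. h \<in> H_set Z \<gamma>)}"
    (is "openin _ ?U")
proof -
  have "sym_diff k h' \<in> ?U"
    if "k \<in> ?U" "h' \<in> carrier (B_group Z)" "\<forall>\<gamma>\<in>F. h' \<in> H_set Z \<gamma>" for k h'
  proof -
    from that(1) obtain h
      where h: "k = sym_diff g h" "h \<in> carrier (B_group Z)" "\<forall>\<gamma>\<in>F. h \<in> H_set Z \<gamma>"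
      by (elim CollectE exE conjE)
    have "sym_diff k h' = sym_diff g (sym_diff h h')" unfolding h(1) by (rule sym_diff_assoc)
    moreover have "sym_diff h h' \<in> carrier (B_group Z)" using h(2) that(2) by auto
    moreover have "\<forall>\<gamma>\<in>F. sym_diff h h' \<in> H_set Z \<gamma>" 
      using h(3) that(3) by (intro ballI H_set_sym_diff) auto
    ultimately show ?thesis by (intro CollectI exI[of _ "sym_diff h h'"] conjI)
  qed
  moreover have "?U \<subseteq> carrier (B_group Z)" using assms by auto
  ultimately show ?thesis
    unfolding openin_Bz mult_B using assms(2,3) by meson
qed

lemma empty_in_H_set [simp]: "{} \<in> H_set Z \<gamma>"
  by (simp add: H_set_def)

theorem Bz_topological_group: "topological_group (B_group Z) (Bz Z)"
proof -
  have "continuous_map (prod_topology (Bz Z) (Bz Z)) (Bz Z) (\<lambda>(x, y). sym_diff x y)"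
    unfolding continuous_map_def
  proof (intro conjI allI impI)
    show "(\<lambda>(x, y). sym_diff x y) \<in>
      topspace (prod_topology (Bz Z) (Bz Z)) \<rightarrow> topspace (Bz Z)" by auto
  next
    fix U assume U: "openin (Bz Z) U"
    show "openin (prod_topology (Bz Z) (Bz Z))
      {p \<in> topspace (prod_topology (Bz Z) (Bz Z)). (case p of (x, y) \<Rightarrow> sym_diff x y) \<in> U}"
      (is "openin _ ?W")
      unfolding openin_prod_topology_alt
    proof (intro allI impI)
      fix x y assume "(x, y) \<in> ?W"
      then have xy: "x \<in> carrier (B_group Z)" "y \<in> carrier (B_group Z)" "sym_diff x y \<in> U"
        by auto
      obtain F where F: "finite F" "F \<subseteq> open_partitions Z"
        "\<And>h. h \<in> carrier (B_group Z) \<Longrightarrow> \<forall>\<gamma>\<in>F. h \<in> H_set Z \<gamma> \<Longrightarrow> sym_diff (sym_diff x y) h \<in> U"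
        using U[unfolded openin_Bz mult_B, THEN conjunct2, rule_format, OF xy(3)] by blast
      let ?N = "\<lambda>g. {sym_diff g h |h. h \<in> carrier (B_group Z) \<and> (\<forall>\<gamma>\<in>F. h \<in> H_set Z \<gamma>)}"
      have self: "g \<in> ?N g" for g by (auto intro!: exI[of _ "{}"])
      have "?N x \<times> ?N y \<subseteq> ?W"
      proof clarify
        fix h k
        assume hk: "h \<in> carrier (B_group Z)" "\<forall>\<gamma>\<in>F. h \<in> H_set Z \<gamma>"
          "k \<in> carrier (B_group Z)" "\<forall>\<gamma>\<in>F. k \<in> H_set Z \<gamma>"
        have "sym_diff h k \<in> carrier (B_group Z)" using hk by auto
        moreover have "\<forall>\<gamma>\<in>F. sym_diff h k \<in> H_set Z \<gamma>" 
          using hk(2,4) by (intro ballI H_set_sym_diff) auto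
        ultimately have "sym_diff (sym_diff x y) (sym_diff h k) \<in> U" by (rule F(3))
        moreover have "sym_diff (sym_diff x y) (sym_diff h k)
            = sym_diff (sym_diff x h) (sym_diff y k)" by blast
        ultimately have "sym_diff (sym_diff x h) (sym_diff y k) \<in> U" by (simp only:)
        moreover have "sym_diff x h \<in> topspace (Bz Z)" "sym_diff y k \<in> topspace (Bz Z)"
          using xy hk by auto
        ultimately show "(sym_diff x h, sym_diff y k) \<in> topspace (prod_topology (Bz Z) (Bz Z)) \<and>
            sym_diff (sym_diff x h) (sym_diff y k) \<in> U"
          unfolding topspace_prod_topology by blast
      qed
      then show "\<exists>A B. openin (Bz Z) A \<and> openin (Bz Z) B \<and> x \<in> A \<and> y \<in> B \<and> A \<times> B \<subseteq> ?W"
        using openin_Bz_translate[OF xy(1) F(1,2)] openin_Bz_translate[OF xy(2) F(1,2)]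
          self[of x] self[of y]
        by (intro exI[of _ "?N x"] exI[of _ "?N y"] conjI)
    qed
  qed
  moreover have "continuous_map (Bz Z) (Bz Z) (\<lambda>x. inv\<^bsub>B_group Z\<^esub> x)"
    by (rule continuous_map_eq[OF continuous_map_id]) (metis topspace_Bz id_apply inv_B)
  ultimately show ?thesis
    unfolding topological_group_def mult_B 
    by (intro conjI group_B topspace_Bz)
qed

theorem Bz_nbhd_zero:
  "nbhd_in (Bz Z) {} U \<longleftrightarrow> U \<subseteq> carrier (B_group Z) \<and>
     (\<exists>F. finite F \<and> F \<subseteq> open_partitions Z \<and> carrier (B_group Z) \<inter> (\<Inter>\<gamma>\<in>F. H_set Z \<gamma>) \<subseteq> U)"
proof
  assume "nbhd_in (Bz Z) {} U"
  then obtain V where V: "U \<subseteq> carrier (B_group Z)" "openin (Bz Z) V" "{} \<in> V" "V \<subseteq> U"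
    unfolding nbhd_in_def topspace_Bz by blast
  obtain F where F: "finite F" "F \<subseteq> open_partitions Z"
    "\<And>h. h \<in> carrier (B_group Z) \<Longrightarrow> \<forall>\<gamma>\<in>F. h \<in> H_set Z \<gamma> \<Longrightarrow> sym_diff {} h \<in> V"
    using V(2)[unfolded openin_Bz mult_B, THEN conjunct2, rule_format, OF V(3)] by blast
  then have "carrier (B_group Z) \<inter> (\<Inter>\<gamma>\<in>F. H_set Z \<gamma>) \<subseteq> U" using V(4) by auto
  then show "U \<subseteq> carrier (B_group Z) \<and>
     (\<exists>F. finite F \<and> F \<subseteq> open_partitions Z \<and> carrier (B_group Z) \<inter> (\<Inter>\<gamma>\<in>F. H_set Z \<gamma>) \<subseteq> U)"
    using V(1) F by blast
next
  assume "U \<subseteq> carrier (B_group Z) \<and>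
     (\<exists>F. finite F \<and> F \<subseteq> open_partitions Z \<and> carrier (B_group Z) \<inter> (\<Inter>\<gamma>\<in>F. H_set Z \<gamma>) \<subseteq> U)"
  then obtain F where U: "U \<subseteq> carrier (B_group Z)" and F: "finite F" "F \<subseteq> open_partitions Z"
    "carrier (B_group Z) \<inter> (\<Inter>\<gamma>\<in>F. H_set Z \<gamma>) \<subseteq> U" by blast
  let ?V = "{sym_diff {} h |h. h \<in> carrier (B_group Z) \<and> (\<forall>\<gamma>\<in>F. h \<in> H_set Z \<gamma>)}"
  have "openin (Bz Z) ?V" by (rule openin_Bz_translate[OF _ F(1,2)]) simp
  moreover have "{} \<in> ?V" by simp
  moreover have "?V \<subseteq> U" using F(3) by auto
  ultimately show "nbhd_in (Bz Z) {} U" unfolding nbhd_in_def topspace_Bz using U by blast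
qed

lemma openin_topological_group_B:
  assumes "topological_group (B_group Z) T"
  shows "openin T U \<longleftrightarrow> U \<subseteq> carrier (B_group Z) \<and>
    (\<forall>g\<in>U. nbhd_in T {} {h \<in> carrier (B_group Z). sym_diff g h \<in> U})"
proof -
  have top: "topspace T = carrier (B_group Z)"
    using assms unfolding topological_group_def by blast
  have cont: "continuous_map T T (\<lambda>h. sym_diff g h)" if "g \<in> carrier (B_group Z)" for g
  proof -
    have "continuous_map T (prod_topology T T) (\<lambda>h. (g, h))"
      using that unfolding continuous_map_pairwise o_def fst_conv snd_conv top[symmetric]
      by (simp add: continuous_map_const)
    from continuous_map_compose[OF this] assms
    have "continuous_map T T ((\<lambda>(x, y). sym_diff x y) \<circ> (\<lambda>h. (g, h)))"
      unfolding topological_group_def mult_B by blast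
    then show ?thesis by (simp add: o_def)
  qed
  have pre: "openin T {h \<in> carrier (B_group Z). sym_diff g h \<in> V}"
    if "g \<in> carrier (B_group Z)" "openin T V" for g V
    using openin_continuous_map_preimage[OF cont[OF that(1)] that(2)] unfolding top .
  show ?thesis
  proof (intro iffI conjI ballI)
    assume U: "openin T U"
    then show sub: "U \<subseteq> carrier (B_group Z)" using openin_subset top by metis
    fix g assume "g \<in> U"
    then have "openin T {h \<in> carrier (B_group Z). sym_diff g h \<in> U}" using U sub pre by blast
    moreover have "{} \<in> {h \<in> carrier (B_group Z). sym_diff g h \<in> U}" using \<open>g \<in> U\<close> by simp
    ultimately show "nbhd_in T {} {h \<in> carrier (B_group Z). sym_diff g h \<in> U}"
      unfolding nbhd_in_def top by blast
  next
    assume U: "U \<subseteq> carrier (B_group Z) \<and>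
      (\<forall>g\<in>U. nbhd_in T {} {h \<in> carrier (B_group Z). sym_diff g h \<in> U})"
    show "openin T U"
    proof (subst openin_subopen, intro ballI)
      fix g assume g: "g \<in> U"
      then obtain V where V: "openin T V" "{} \<in> V"
        "V \<subseteq> {h \<in> carrier (B_group Z). sym_diff g h \<in> U}"
        using U unfolding nbhd_in_def by blast
      have gc: "g \<in> carrier (B_group Z)" using g U by blast
      let ?W = "{h \<in> carrier (B_group Z). sym_diff g h \<in> V}"
      have "?W \<subseteq> U"
      proof
        fix h assume "h \<in> ?W"
        then have "sym_diff g (sym_diff g h) \<in> U" using V(3) by blast
        moreover have "sym_diff g (sym_diff g h) = h" by blast
        ultimately show "h \<in> U" by simp
      qed
      moreover have "g \<in> ?W" using gc V(2) by simp
      ultimately show "\<exists>W. openin T W \<and> g \<in> W \<and> W \<subseteq> U" using pre[OF gc V(1)] by blast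
    qed
  qed
qed

theorem Bz_unique:
  assumes "topological_group (B_group Z) T"
    and "\<And>U. nbhd_in T {} U \<longleftrightarrow> U \<subseteq> carrier (B_group Z) \<and>
      (\<exists>F. finite F \<and> F \<subseteq> open_partitions Z \<and> carrier (B_group Z) \<inter> (\<Inter>\<gamma>\<in>F. H_set Z \<gamma>) \<subseteq> U)"
  shows "T = Bz Z"
  unfolding topology_eq openin_topological_group_B[OF assms(1)]
    openin_topological_group_B[OF Bz_topological_group] assms(2) Bz_nbhd_zero
  by (intro allI refl)

end

theory Submission
  imports Defs
begin

text \<open>For a finite \<open>g\<close> record the parities of \<open>|g \<inter> [s]|\<close> over all binary words \<open>s\<close>, where \<open>[s]\<close> is
  the cylinder of \<open>s\<close>. Since the Cantor set is compact, every open partition is refined by the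
  cylinders of some fixed length, so the neighbourhoods of \<open>g\<close> are given by finitely many parities.
  Thus \<open>g \<mapsto> parity g\<close> embeds the group into a countable power of the two-point space, and
  precompactness holds because only finitely many parity patterns of bounded length exist.

  If \<open>|g|\<close> is odd, then each odd cylinder splits into one odd and one even half. Following the odd
  halves yields a point \<open>r(g)\<close>, and \<open>r(g) \<in> g\<close> because \<open>g\<close> is finite and meets all cylinders on the
  way; so \<open>r\<close> maps subsets of \<open>X\<close> into \<open>X\<close>. Its first \<open>n\<close> digits depend on the parities up to
  length \<open>n\<close> only, which is continuity. For openness, replacing \<open>r(g)\<close> in \<open>g\<close> by a point \<open>x\<close>
  that is close enough gives an element near \<open>g\<close> which \<open>r\<close> sends to \<open>x\<close>.\<close>

section \<open>Cylinders and parities\<close>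

text \<open>A rank \<open>m\<close> with finite sublevel sets turns the basic neighbourhoods, which
  fix finitely many coordinates, into a sequence indexed by a level \<open>n\<close>. The index type
  is arbitrary because two instances occur: \<open>cantor\<close> with the coordinate itself as
  rank, and the power indexed by binary words with \<open>length\<close> as rank.\<close>

lemma openin_product_discrete_topology:
  fixes m :: "'i \<Rightarrow> nat"
  assumes fin: "\<And>n. finite {i. m i < n}"
  shows "openin (product_topology (\<lambda>_. discrete_topology UNIV) UNIV) U \<longleftrightarrow>
    (\<forall>x\<in>U. \<exists>n. \<forall>y. (\<forall>i. m i < n \<longrightarrow> y i = x i) \<longrightarrow> y \<in> U)"
    (is "?open \<longleftrightarrow> ?loc")
proof
  assume U: ?open
  show ?loc
  proof
    fix x assume "x \<in> U"
    then obtain V where V: "finite {i. V i \<noteq> UNIV}" "x \<in> Pi\<^sub>E UNIV V" "Pi\<^sub>E UNIV V \<subseteq> U"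
      using U unfolding openin_product_topology_alt by auto
    \<comment> \<open>\<open>insert 0\<close> keeps \<open>Max\<close> meaningful when no coordinate
      is restricted; \<open>Suc\<close> makes the bound strict. The same pattern recurs
      below.\<close>
    define n where "n = Suc (Max (insert 0 (m ` {i. V i \<noteq> UNIV})))"
    have "m i < n" if "V i \<noteq> UNIV" for i
      unfolding n_def using V(1) that by (intro le_imp_less_Suc Max_ge) auto
    then have "y i \<in> V i" if "\<forall>i. m i < n \<longrightarrow> y i = x i" for y i
      using V(2) that by (cases "V i = UNIV") (auto simp: PiE_iff)
    then have "y \<in> Pi\<^sub>E UNIV V" if "\<forall>i. m i < n \<longrightarrow> y i = x i" for y
      using that by (simp add: PiE_iff)
    then show "\<exists>n. \<forall>y. (\<forall>i. m i < n \<longrightarrow> y i = x i) \<longrightarrow> y \<in> U"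
      using V(3) by (intro exI[of _ n] allI impI) (rule subsetD)
  qed
next
  assume loc: ?loc
  show ?open
    unfolding openin_product_topology_alt
  proof (intro ballI)
    fix x assume "x \<in> U"
    then obtain n where n: "\<And>y. (\<forall>i. m i < n \<longrightarrow> y i = x i) \<Longrightarrow> y \<in> U"
      using loc by blast
    let ?V = "\<lambda>i. if m i < n then {x i} else UNIV"
    have "finite {i. ?V i \<noteq> UNIV}"
      by (rule finite_subset[OF _ fin[of n]]) auto
    moreover have "Pi\<^sub>E UNIV ?V \<subseteq> U"
    proof
      fix y assume "y \<in> Pi\<^sub>E UNIV ?V"
      then have "\<forall>i. m i < n \<longrightarrow> y i = x i" by (auto simp: PiE_iff split: if_splits)
      then show "y \<in> U" by (rule n)
    qed
    ultimately show "\<exists>V. finite {i \<in> UNIV. V i \<noteq> topspace (discrete_topology UNIV)} \<and>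
        (\<forall>i\<in>UNIV. openin (discrete_topology UNIV) (V i)) \<and> x \<in> Pi\<^sub>E UNIV V \<and> Pi\<^sub>E UNIV V \<subseteq> U"
      by (intro exI[of _ ?V]) (auto simp: PiE_iff)
  qed
qed

lemma topspace_cantor [simp]: "topspace cantor = UNIV"
  by (simp add: cantor_def)

lemma openin_cantor:
  "openin cantor U \<longleftrightarrow> (\<forall>x\<in>U. \<exists>n. \<forall>y. (\<forall>i<n. y i = x i) \<longrightarrow> y \<in> U)"
  unfolding cantor_def by (rule openin_product_discrete_topology) auto

lemma openin_cantorE:
  assumes "openin cantor U" "x \<in> U"
  obtains n where "\<And>y. (\<forall>i<n. y i = x i) \<Longrightarrow> y \<in> U"
proof -
  have "\<exists>n. \<forall>y. (\<forall>i<n. y i = x i) \<longrightarrow> y \<in> U"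
    using assms(1)[unfolded openin_cantor] assms(2) by (rule bspec)
  then obtain n where "\<forall>y. (\<forall>i<n. y i = x i) \<longrightarrow> y \<in> U" ..
  then show ?thesis by (intro that[of n]) simp
qed

lemma compact_space_cantor: "compact_space cantor"
  unfolding cantor_def by (simp add: compact_space_product_topology compact_space_discrete_topology)

definition cyl :: "bool list \<Rightarrow> (nat \<Rightarrow> bool) set" where
  "cyl s = {x. \<forall>i<length s. x i = s ! i}"

abbreviation pre :: "nat \<Rightarrow> (nat \<Rightarrow> bool) \<Rightarrow> bool list" where
  "pre n x \<equiv> map x [0..<n]"

lemma cyl_Nil [simp]: "cyl [] = UNIV"
  by (simp add: cyl_def)

lemma mem_cyl_pre: "y \<in> cyl (pre n x) \<longleftrightarrow> (\<forall>i<n. y i = x i)"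
  by (auto simp: cyl_def)

text \<open>In this form it is immediate that each point lies in the cylinder of exactly one word of
  each length, so that cylinders of distinct words of equal length are disjoint.\<close>

lemma mem_cyl_iff: "x \<in> cyl s \<longleftrightarrow> pre (length s) x = s"
proof
  assume "x \<in> cyl s"
  then show "pre (length s) x = s" by (intro nth_equalityI) (auto simp: cyl_def)
next
  assume "pre (length s) x = s"
  then have "pre (length s) x ! i = s ! i" for i by simp
  then show "x \<in> cyl s" by (force simp: cyl_def)
qed

lemma openin_cyl: "openin cantor (cyl s)"
  unfolding openin_cantor cyl_def by (auto intro!: exI[of _ "length s"])

lemma finite_lists_shorter: "finite {s :: bool list. length s < n}"
proof -
  have "finite {s :: bool list. set s \<subseteq> UNIV \<and> length s \<le> n}"
    by (rule finite_lists_length_le) simp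
  then show ?thesis by (rule rev_finite_subset) auto
qed

text \<open>For fixed \<open>s\<close> this is a character of the Boolean group of finite sets; the
  topology turns out to be the one generated by these characters.\<close>

definition parity :: "(nat \<Rightarrow> bool) set \<Rightarrow> bool list \<Rightarrow> bool" where
  "parity g s \<longleftrightarrow> odd (card (g \<inter> cyl s))"

lemma parity_sym_diff:
  assumes "finite g" "finite h"
  shows "parity (sym_diff g h) s \<longleftrightarrow> parity g s \<noteq> parity h s"
proof -
  have "sym_diff g h \<inter> cyl s = sym_diff (g \<inter> cyl s) (h \<inter> cyl s)" by blast
  then show ?thesis
    using assms even_card_sym_diff[of "g \<inter> cyl s" "h \<inter> cyl s"] by (auto simp: parity_def)
qed

lemma parity_empty [simp]: "\<not> parity {} s"
  by (simp add: parity_def)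

lemma parity_singleton [simp]: "parity {x} s \<longleftrightarrow> x \<in> cyl s"
  by (cases "x \<in> cyl s") (simp_all add: parity_def)

lemma parity_Nil: "parity g [] \<longleftrightarrow> odd (card g)"
  by (simp add: parity_def)

text \<open>Each of the finitely many points of \<open>g\<close> other than \<open>x\<close> differs
  from \<open>x\<close> in some coordinate, and \<open>n\<close> exceeds one such coordinate for
  each. An inclusion is stated because \<open>x\<close> may lie outside \<open>g\<close>.\<close>

lemma isolating_level:
  assumes "finite g"
  obtains n where "g \<inter> cyl (pre n x) \<subseteq> {x}"
proof -
  have "\<forall>y. \<exists>k. y \<noteq> x \<longrightarrow> y k \<noteq> x k" by blast
  then obtain k where k: "y \<noteq> x \<Longrightarrow> y (k y) \<noteq> x (k y)" for y by metis
  define n where "n = Suc (Max (insert 0 (k ` g)))"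
  have "k y < n" if "y \<in> g" for y
    unfolding n_def using assms that by (intro le_imp_less_Suc Max_ge) auto
  then have "g \<inter> cyl (pre n x) \<subseteq> {x}"
    using k by (auto simp: mem_cyl_pre) metis
  then show ?thesis by (rule that)
qed

text \<open>A point of the symmetric difference, isolated there by a long prefix, gives a cylinder
  on which the two parities differ.\<close>

lemma inj_parity: "inj_on parity {g. finite g}"
proof (rule inj_onI)
  fix g h assume gh: "g \<in> {g. finite g}" "h \<in> {g. finite g}" "parity g = parity h"
  show "g = h"
  proof (rule ccontr)
    assume "g \<noteq> h"
    then obtain x where x: "x \<in> sym_diff g h" by blast
    obtain n where "sym_diff g h \<inter> cyl (pre n x) \<subseteq> {x}"
      using isolating_level[of "sym_diff g h" x] gh by auto
    then have "sym_diff g h \<inter> cyl (pre n x) = {x}"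
      using x by (auto simp: mem_cyl_pre)
    then have "parity (sym_diff g h) (pre n x)" by (simp add: parity_def)
    then show False using gh parity_sym_diff by simp
  qed
qed

section \<open>Neighbourhoods in terms of parities\<close>

lemma open_partition_cylinders:
  "cyl ` {s. length s = n} \<in> open_partitions cantor"
proof -
  have "partition_on UNIV (cyl ` {s. length s = n})"
  proof (rule partition_onI)
    show "\<Union> (cyl ` {s. length s = n}) = UNIV"
      by (auto simp: mem_cyl_iff)
  next
    fix p q assume "p \<in> cyl ` {s. length s = n}" "q \<in> cyl ` {s. length s = n}" "p \<noteq> q"
    then show "disjnt p q" by (auto simp: disjnt_def mem_cyl_iff)
  next
    have "(\<lambda>i. s ! i) \<in> cyl s" for s by (simp add: cyl_def)
    then show "{} \<notin> cyl ` {s. length s = n}" by blast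
  qed
  then show ?thesis by (auto simp: open_partitions_def openin_cyl)
qed

text \<open>Compactness: the cylinders contained in members of \<open>\<gamma>\<close> cover the
  space, and \<open>n\<close> is the largest word length in a finite subcover. Every word of length
  \<open>n\<close> then extends a word of the subcover.\<close>

lemma open_partition_refined:
  assumes "\<gamma> \<in> open_partitions cantor"
  obtains n where "\<And>s. length s = n \<Longrightarrow> \<exists>U\<in>\<gamma>. cyl s \<subseteq> U"
proof -
  have un: "\<Union>\<gamma> = UNIV" and op: "\<And>U. U \<in> \<gamma> \<Longrightarrow> openin cantor U"
    using assms by (auto simp: open_partitions_def partition_on_def)
  define \<U> where "\<U> = {cyl s |s. \<exists>U\<in>\<gamma>. cyl s \<subseteq> U}"
  have cov: "x \<in> \<Union>\<U>" for x
  proof -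
    have "x \<in> \<Union>\<gamma>" by (simp add: un)
    then obtain U where U: "U \<in> \<gamma>" "x \<in> U" by (rule UnionE)
    obtain n where "\<And>y. (\<forall>i<n. y i = x i) \<Longrightarrow> y \<in> U"
      using openin_cantorE[OF op[OF U(1)] U(2)] by metis
    then have "cyl (pre n x) \<subseteq> U" by (auto simp: mem_cyl_pre)
    moreover have "x \<in> cyl (pre n x)" by (simp add: mem_cyl_pre)
    ultimately show ?thesis unfolding \<U>_def using U by blast
  qed
  have "\<forall>C\<in>\<U>. openin cantor C" using openin_cyl unfolding \<U>_def by blast
  moreover have "UNIV \<subseteq> \<Union>\<U>" using cov by blast
  ultimately obtain \<F> where F: "finite \<F>" "\<F> \<subseteq> \<U>" "UNIV \<subseteq> \<Union>\<F>"
    using compact_space_cantor[unfolded compact_space_alt topspace_cantor, rule_format, of \<U>] by blast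
  have "\<forall>C\<in>\<F>. \<exists>s. C = cyl s \<and> (\<exists>U\<in>\<gamma>. cyl s \<subseteq> U)" using F(2) unfolding \<U>_def by blast
  then obtain w where w: "\<And>C. C \<in> \<F> \<Longrightarrow> C = cyl (w C)" "\<And>C. C \<in> \<F> \<Longrightarrow> \<exists>U\<in>\<gamma>. C \<subseteq> U"
    by metis
  define n where "n = Max (insert 0 ((length \<circ> w) ` \<F>))"
  have wn: "length (w C) \<le> n" if "C \<in> \<F>" for C
    unfolding n_def using F(1) that by (intro Max_ge) auto
  have "\<exists>U\<in>\<gamma>. cyl s \<subseteq> U" if s: "length s = n" for s
  proof -
    \<comment> \<open>One point decides for the whole cylinder: as \<open>w C\<close> is no longer
      than \<open>s\<close>, a single point of \<open>cyl s\<close> in \<open>C\<close> makes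
      \<open>w C\<close> a prefix of \<open>s\<close>.\<close>
    obtain C where C: "C \<in> \<F>" "(\<lambda>i. s ! i) \<in> C" using F(3) by blast
    have "(\<lambda>i. s ! i) \<in> cyl (w C)" using C(2) w(1)[OF C(1)] by simp
    then have "cyl s \<subseteq> cyl (w C)" using wn[OF C(1)] s by (auto simp: cyl_def)
    then have "cyl s \<subseteq> C" using w(1)[OF C(1)] by simp
    then show ?thesis using w(2)[OF C(1)] by blast
  qed
  then show ?thesis by (rule that)
qed

lemma H_set_cylinders:
  "h \<in> H_set cantor (cyl ` {s. length s = n}) \<longleftrightarrow>
    finite h \<and> (\<forall>s. length s = n \<longrightarrow> \<not> parity h s)"
  by (auto simp: H_set_def parity_def)

text \<open>A member \<open>U\<close> of \<open>\<gamma>\<close> is the disjoint union of the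
  cylinders of level \<open>n\<close> inside it, so \<open>card (h \<inter> U)\<close> is a sum of
  even numbers.\<close>

lemma H_set_refine:
  assumes "\<gamma> \<in> open_partitions cantor" "\<And>s. length s = n \<Longrightarrow> \<exists>U\<in>\<gamma>. cyl s \<subseteq> U"
  shows "H_set cantor (cyl ` {s. length s = n}) \<subseteq> H_set cantor \<gamma>"
proof
  fix h assume "h \<in> H_set cantor (cyl ` {s. length s = n})"
  then have h: "finite h" "\<And>s. length s = n \<Longrightarrow> even (card (h \<inter> cyl s))"
    by (auto simp: H_set_cylinders parity_def)
  have "even (card (h \<inter> U))" if U: "U \<in> \<gamma>" for U
  proof -
    let ?S = "{s. length s = n \<and> cyl s \<subseteq> U}"
    have fin: "finite ?S"
      by (rule finite_subset[OF _ finite_lists_shorter[of "Suc n"]]) auto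
    have "U \<subseteq> (\<Union>s\<in>?S. cyl s)"
    proof
      fix x assume x: "x \<in> U"
      have xc: "x \<in> cyl (pre n x)" by (simp add: mem_cyl_pre)
      obtain V where V: "V \<in> \<gamma>" "cyl (pre n x) \<subseteq> V" using assms(2)[of "pre n x"] by auto
      have "V = U"
        using V U x xc assms(1) unfolding open_partitions_def partition_on_def disjoint_def by blast
      then show "x \<in> (\<Union>s\<in>?S. cyl s)" using V(2) xc by force
    qed
    then have "h \<inter> U = (\<Union>s\<in>?S. h \<inter> cyl s)" by blast
    also have "card \<dots> = (\<Sum>s\<in>?S. card (h \<inter> cyl s))"
      using fin h(1) by (intro card_UN_disjoint) (auto simp: mem_cyl_iff)
    finally show ?thesis using h(2) by (auto intro: dvd_sum)
  qed
  then show "h \<in> H_set cantor \<gamma>" using h(1) by (simp add: H_set_def)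
qed

text \<open>The working description of the topology, used in place of partitions from here on. If
  \<open>g\<close> and \<open>h\<close> have equal parities below level \<open>n\<close>, their
  difference is even on those cylinders; by refinement it lies in each \<open>H_set\<close> whose
  level is below \<open>n\<close>. Conversely, evenness below level \<open>n\<close> is membership
  in finitely many sets \<open>H_set\<close> of cylinder partitions.\<close>

lemma openin_Bz_cantor:
  "openin (Bz cantor) U \<longleftrightarrow> U \<subseteq> {g. finite g} \<and>
    (\<forall>g\<in>U. \<exists>n. \<forall>h. finite h \<and> (\<forall>s. length s < n \<longrightarrow> parity h s = parity g s) \<longrightarrow> h \<in> U)"
    (is "_ \<longleftrightarrow> _ \<and> ?loc")
proof (rule iffI; (rule conjI)?)
  assume U: "openin (Bz cantor) U"
  show sub: "U \<subseteq> {g. finite g}" using openin_subset[OF U] by simp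
  show ?loc
  proof
    fix g assume g: "g \<in> U"
    then have "finite g" using sub by blast
    obtain F where F: "finite F" "F \<subseteq> open_partitions cantor"
      "\<And>h. finite h \<Longrightarrow> \<forall>\<gamma>\<in>F. h \<in> H_set cantor \<gamma> \<Longrightarrow> sym_diff g h \<in> U"
      using U[unfolded openin_Bz mult_B, THEN conjunct2, rule_format, OF g] by auto
    have "\<forall>\<gamma>\<in>F. \<exists>n. \<forall>s. length s = n \<longrightarrow> (\<exists>U\<in>\<gamma>. cyl s \<subseteq> U)"
      using open_partition_refined F(2) by (metis subsetD)
    then obtain N where N: "\<And>\<gamma> s. \<gamma> \<in> F \<Longrightarrow> length s = N \<gamma> \<Longrightarrow> \<exists>U\<in>\<gamma>. cyl s \<subseteq> U"
      by metis
    define n where "n = Suc (Max (insert 0 (N ` F)))"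
    have Nn: "N \<gamma> < n" if "\<gamma> \<in> F" for \<gamma>
      unfolding n_def using F(1) that by (intro le_imp_less_Suc Max_ge) auto
    have "h \<in> U" if h: "finite h" "\<forall>s. length s < n \<longrightarrow> parity h s = parity g s" for h
    proof -
      have "sym_diff g h \<in> H_set cantor \<gamma>" if "\<gamma> \<in> F" for \<gamma>
      proof (rule subsetD[OF H_set_refine])
        show "sym_diff g h \<in> H_set cantor (cyl ` {s. length s = N \<gamma>})"
          using h \<open>finite g\<close> Nn[OF that] by (simp add: H_set_cylinders parity_sym_diff)
      qed (use that F(2) N in auto)
      moreover have "finite (sym_diff g h)" using h(1) \<open>finite g\<close> by blast
      ultimately have "sym_diff g (sym_diff g h) \<in> U" by (intro F(3)) auto
      moreover have "sym_diff g (sym_diff g h) = h" by blast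
      ultimately show "h \<in> U" by simp
    qed
    then show "\<exists>n. \<forall>h. finite h \<and> (\<forall>s. length s < n \<longrightarrow> parity h s = parity g s) \<longrightarrow> h \<in> U"
      by blast
  qed
next
  assume U: "U \<subseteq> {g. finite g} \<and> ?loc"
  show "openin (Bz cantor) U"
    unfolding openin_Bz
  proof (intro conjI ballI)
    show "U \<subseteq> carrier (B_group cantor)" using U by simp
    fix g assume g: "g \<in> U"
    then have fg: "finite g" using U by blast
    have "\<exists>n. \<forall>h. finite h \<and> (\<forall>s. length s < n \<longrightarrow> parity h s = parity g s) \<longrightarrow> h \<in> U"
      using conjunct2[OF U] g by (rule bspec)
    then obtain n
      where "\<forall>h. finite h \<and> (\<forall>s. length s < n \<longrightarrow> parity h s = parity g s) \<longrightarrow> h \<in> U" ..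
    then have n: "h \<in> U" if "finite h" "\<forall>s. length s < n \<longrightarrow> parity h s = parity g s" for h
      using that by simp
    let ?F = "(\<lambda>k. cyl ` {s. length s = k}) ` {..<n}"
    have "sym_diff g h \<in> U" if h: "finite h" "\<forall>\<gamma>\<in>?F. h \<in> H_set cantor \<gamma>" for h
    proof (rule n)
      show "finite (sym_diff g h)" using fg h(1) by blast
      show "\<forall>s. length s < n \<longrightarrow> parity (sym_diff g h) s = parity g s"
        using h fg by (auto simp: parity_sym_diff H_set_cylinders)
    qed
    then show "\<exists>F. finite F \<and> F \<subseteq> open_partitions cantor \<and>
        (\<forall>h\<in>carrier (B_group cantor). (\<forall>\<gamma>\<in>F. h \<in> H_set cantor \<gamma>) \<longrightarrow>
          g \<otimes>\<^bsub>B_group cantor\<^esub> h \<in> U)"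
      using open_partition_cylinders by (intro exI[of _ ?F]) auto
  qed
qed

lemma openin_Bz_cantorE:
  assumes "openin (Bz cantor) U" "g \<in> U"
  obtains n where "finite g"
    "\<And>h. finite h \<Longrightarrow> \<forall>s. length s < n \<longrightarrow> parity h s = parity g s \<Longrightarrow> h \<in> U"
proof -
  note U = assms(1)[unfolded openin_Bz_cantor]
  have "finite g" using U assms(2) by blast
  have "\<exists>n. \<forall>h. finite h \<and> (\<forall>s. length s < n \<longrightarrow> parity h s = parity g s) \<longrightarrow> h \<in> U"
    using conjunct2[OF U] assms(2) by (rule bspec)
  then obtain n
    where "\<forall>h. finite h \<and> (\<forall>s. length s < n \<longrightarrow> parity h s = parity g s) \<longrightarrow> h \<in> U" ..
  then show ?thesis by (intro that[of n] \<open>finite g\<close>) simp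
qed

text \<open>Here \<open>n\<close> is the same for all \<open>g\<close>. Having equal parities below
  level \<open>n\<close> is an equivalence relation, so the complement of \<open>U\<close> is also a
  union of classes and hence open.\<close>

lemma clopen_Bz_cantor:
  assumes "U \<subseteq> {g. finite g}"
    and "\<And>g h. g \<in> U \<Longrightarrow> finite h \<Longrightarrow> \<forall>s. length s < n \<longrightarrow> parity h s = parity g s \<Longrightarrow> h \<in> U"
  shows "openin (Bz cantor) U" "closedin (Bz cantor) U"
proof -
  show "openin (Bz cantor) U"
    unfolding openin_Bz_cantor using assms by blast
  have "openin (Bz cantor) ({g. finite g} - U)"
    unfolding openin_Bz_cantor by (intro conjI ballI exI[of _ n]) (use assms(2) in auto)
  then show "closedin (Bz cantor) U"
    using assms(1) by (simp add: closedin_def)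
qed

section \<open>Metrizability, countability and precompactness\<close>

lemma embedding_map_parity:
  "embedding_map (Bz cantor) (product_topology (\<lambda>_. discrete_topology UNIV) UNIV) parity"
proof -
  let ?P = "product_topology (\<lambda>_. discrete_topology UNIV) UNIV :: (bool list \<Rightarrow> bool) topology"
  have openP: "openin ?P W \<longleftrightarrow>
      (\<forall>f\<in>W. \<exists>n. \<forall>f'. (\<forall>s. length s < n \<longrightarrow> f' s = f s) \<longrightarrow> f' \<in> W)" for W
    by (rule openin_product_discrete_topology) (rule finite_lists_shorter)
  have "continuous_map (Bz cantor) ?P parity"
    unfolding continuous_map
  proof (intro conjI allI impI)
    fix W assume W: "openin ?P W"
    show "openin (Bz cantor) {g \<in> topspace (Bz cantor). parity g \<in> W}"
      unfolding openin_Bz_cantor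
    proof (intro conjI ballI)
      fix g assume "g \<in> {g \<in> topspace (Bz cantor). parity g \<in> W}"
      then have "parity g \<in> W" by simp
      with W[unfolded openP]
      have "\<exists>n. \<forall>f'. (\<forall>s. length s < n \<longrightarrow> f' s = parity g s) \<longrightarrow> f' \<in> W" by (rule bspec)
      then obtain n where "\<forall>f'. (\<forall>s. length s < n \<longrightarrow> f' s = parity g s) \<longrightarrow> f' \<in> W" ..
      then show "\<exists>n. \<forall>h. finite h \<and> (\<forall>s. length s < n \<longrightarrow> parity h s = parity g s) \<longrightarrow>
          h \<in> {g \<in> topspace (Bz cantor). parity g \<in> W}"
        by (intro exI[of _ n]) auto
    qed auto
  qed auto
  moreover have "open_map (Bz cantor) (subtopology ?P (parity ` topspace (Bz cantor))) parity"
    unfolding open_map_def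
  proof (intro allI impI)
    fix U assume U: "openin (Bz cantor) U"
    let ?good = "\<lambda>g n. \<forall>h. finite h \<and> (\<forall>s. length s < n \<longrightarrow> parity h s = parity g s) \<longrightarrow> h \<in> U"
    \<comment> \<open>\<open>W\<close> is the union of all basic open sets that force membership in
      \<open>U\<close>. Carrying the level \<open>n\<close> inside the definition makes
      \<open>W\<close> open, and \<open>?good\<close> ensures that a finite set with parities in
      \<open>W\<close> belongs to \<open>U\<close>.\<close>
    define W where "W = {f. \<exists>g\<in>U. \<exists>n. ?good g n \<and> (\<forall>s. length s < n \<longrightarrow> f s = parity g s)}"
    have "openin ?P W"
      unfolding openP
    proof
      fix f assume "f \<in> W"
      then obtain g n where gn: "g \<in> U" "?good g n" "\<forall>s. length s < n \<longrightarrow> f s = parity g s"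
        unfolding W_def by blast
      then show "\<exists>n. \<forall>f'. (\<forall>s. length s < n \<longrightarrow> f' s = f s) \<longrightarrow> f' \<in> W"
        unfolding W_def by (intro exI[of _ n] allI impI CollectI bexI[of _ g] exI[of _ n] conjI) auto
    qed
    moreover have "parity ` U = W \<inter> parity ` {g. finite g}"
    proof
      show "parity ` U \<subseteq> W \<inter> parity ` {g. finite g}"
      proof (rule image_subsetI)
        fix g assume g: "g \<in> U"
        obtain n where "finite g" "?good g n"
          using openin_Bz_cantorE[OF U g] by metis
        then show "parity g \<in> W \<inter> parity ` {g. finite g}"
          using g unfolding W_def by blast
      qed
      show "W \<inter> parity ` {g. finite g} \<subseteq> parity ` U"
        unfolding W_def by blast
    qed
    ultimately show "openin (subtopology ?P (parity ` topspace (Bz cantor))) (parity ` U)"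
      unfolding openin_subtopology by auto
  qed
  ultimately show ?thesis
    unfolding embedding_map_def using inj_parity
    by (intro bijective_open_imp_homeomorphic_map) (auto simp: continuous_map_in_subtopology)
qed

lemma metrizable_Bz_cantor: "metrizable_space (Bz cantor)"
proof -
  have "metrizable_space
      (product_topology (\<lambda>_. discrete_topology UNIV) UNIV :: (bool list \<Rightarrow> bool) topology)"
    unfolding metrizable_space_product_topology by simp
  then show ?thesis
    using embedding_map_imp_homeomorphic_space[OF embedding_map_parity]
      homeomorphic_metrizable_space metrizable_space_subtopology by blast
qed

text \<open>Second countability is proved, and separability derived from it, because it passes to
  the subspaces of even sets. A basic set is coded by a level and the finite set of words that are
  odd below it.\<close>

lemma second_countable_Bz_cantor: "second_countable (Bz cantor)"
proof -
  define E where "E n A = {h. finite h \<and> (\<forall>s. length s < n \<longrightarrow> parity h s = (s \<in> A))}"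
    for n and A :: "bool list set"
  let ?\<B> = "(\<lambda>(n, A). E n A) ` (UNIV \<times> Collect finite)"
  have "countable ?\<B>" by (intro countable_image countable_SIGMA countable_Collect_finite) simp
  moreover have "openin (Bz cantor) (E n A)" for n A
    by (rule clopen_Bz_cantor(1)[of _ n]) (auto simp: E_def)
  moreover have "\<exists>V\<in>?\<B>. g \<in> V \<and> V \<subseteq> U" if U: "openin (Bz cantor) U" "g \<in> U" for U g
  proof -
    obtain n where fg: "finite g"
      and n: "\<And>h. finite h \<Longrightarrow> \<forall>s. length s < n \<longrightarrow> parity h s = parity g s \<Longrightarrow> h \<in> U"
      using openin_Bz_cantorE[OF U] by metis
    let ?A = "{s. length s < n \<and> parity g s}"
    have "finite ?A" by (rule finite_subset[OF _ finite_lists_shorter[of n]]) auto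
    moreover have "g \<in> E n ?A" "E n ?A \<subseteq> U" using fg n by (auto simp: E_def)
    ultimately show ?thesis by blast
  qed
  ultimately show ?thesis
    unfolding second_countable_def by (intro exI[of _ ?\<B>]) auto
qed

lemma dim_Bz_cantor: "Bz cantor dim_le 0"
  unfolding dimension_le_0_neighbourhood_base_of_clopen neighbourhood_base_of
proof (intro allI impI, elim conjE)
  fix W g assume W: "openin (Bz cantor) W" "g \<in> W"
  obtain n where fg: "finite g"
    and n: "\<And>h. finite h \<Longrightarrow> \<forall>s. length s < n \<longrightarrow> parity h s = parity g s \<Longrightarrow> h \<in> W"
    using openin_Bz_cantorE[OF W] by metis
  let ?V = "{h. finite h \<and> (\<forall>s. length s < n \<longrightarrow> parity h s = parity g s)}"
  have "openin (Bz cantor) ?V" "closedin (Bz cantor) ?V"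
    by (rule clopen_Bz_cantor[of _ n]; auto)+
  then show "\<exists>U V. openin (Bz cantor) U \<and> (closedin (Bz cantor) V \<and> openin (Bz cantor) V) \<and>
      g \<in> U \<and> U \<subseteq> V \<and> V \<subseteq> W"
    using fg n by (intro exI[of _ ?V]) auto
qed

lemma topological_group_subgroup:
  assumes G: "topological_group G T" and K: "subgroup K G"
  shows "topological_group (G\<lparr>carrier := K\<rparr>) (subtopology T K)"
proof -
  interpret group G using G by (simp add: topological_group_def)
  have top: "topspace T = carrier G" using G by (simp add: topological_group_def)
  have sub: "K \<subseteq> carrier G" using K by (rule subgroup.subset)
  have "continuous_map (prod_topology (subtopology T K) (subtopology T K)) (subtopology T K)
      (\<lambda>(x, y). x \<otimes>\<^bsub>G\<^esub> y)"
    unfolding subtopology_Times[symmetric]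
    using G subgroup.m_closed[OF K]
    by (auto simp: topological_group_def continuous_map_in_subtopology
        intro: continuous_map_from_subtopology)
  moreover have "continuous_map (subtopology T K) (subtopology T K) (\<lambda>x. inv\<^bsub>G\<^esub> x)"
    using G subgroup.m_inv_closed[OF K]
    by (auto simp: topological_group_def continuous_map_in_subtopology
        intro: continuous_map_from_subtopology)
  \<comment> \<open>The inverse of the restricted structure is known to agree with that of
    \<open>G\<close> on \<open>K\<close> only, which suffices for continuity on the
    subspace.\<close>
  then have "continuous_map (subtopology T K) (subtopology T K) (\<lambda>x. inv\<^bsub>G\<lparr>carrier := K\<rparr>\<^esub> x)"
    by (rule continuous_map_eq) (use sub top m_inv_consistent[OF K] in auto)
  ultimately show ?thesis
    using subgroup_imp_group[OF K] sub top by (auto simp: topological_group_def)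
qed

text \<open>Pigeonhole on the finitely many parity patterns below level \<open>n\<close>: if
  \<open>a\<close> has the pattern of \<open>g\<close>, then \<open>a + g\<close> has trivial
  pattern, hence lies in \<open>U\<close>, and \<open>g = a + (a + g)\<close>. Allowing any subgroup
  covers the whole group and the even subgroups at once.\<close>

lemma precompact_subgroup_Bz_cantor:
  assumes K: "subgroup K (B_group cantor)"
  shows "precompact_group ((B_group cantor)\<lparr>carrier := K\<rparr>) (subtopology (Bz cantor) K)"
  unfolding precompact_group_def
proof (intro conjI allI impI)
  show "topological_group ((B_group cantor)\<lparr>carrier := K\<rparr>) (subtopology (Bz cantor) K)"
    by (rule topological_group_subgroup[OF Bz_topological_group K])
next
  have fin: "finite g" if "g \<in> K" for g using subgroup.subset[OF K] that by auto
  fix U assume "nbhd_in (subtopology (Bz cantor) K) \<one>\<^bsub>(B_group cantor)\<lparr>carrier := K\<rparr>\<^esub> U"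
  then obtain W where W: "openin (Bz cantor) W" "{} \<in> W" "W \<inter> K \<subseteq> U"
    unfolding nbhd_in_def openin_subtopology by auto
  obtain n where n: "\<And>h. finite h \<Longrightarrow> \<forall>s. length s < n \<longrightarrow> parity h s = parity {} s \<Longrightarrow> h \<in> W"
    using openin_Bz_cantorE[OF W(1,2)] by metis
  let ?sig = "\<lambda>g. {s. length s < n \<and> parity g s}"
  have "?sig ` K \<subseteq> Pow {s. length s < n}" by blast
  then have "finite (?sig ` K)" by (rule finite_subset) (simp add: finite_lists_shorter)
  \<comment> \<open>Representatives of the patterns are chosen in \<open>K\<close>, since the
    translating elements must belong to the subgroup.\<close>
  then obtain F where F: "finite F" "F \<subseteq> K" "?sig ` K = ?sig ` F"
    by (meson finite_subset_image subset_refl)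
  have "g \<in> (\<Union>a\<in>F. a <#\<^bsub>(B_group cantor)\<lparr>carrier := K\<rparr>\<^esub> U)" if g: "g \<in> K" for g
  proof -
    obtain a where a: "a \<in> F" "?sig g = ?sig a" using F(3) g by blast
    have aK: "a \<in> K" using a(1) F(2) by blast
    have "sym_diff a g \<in> K" using subgroup.m_closed[OF K aK g] by simp
    moreover have "sym_diff a g \<in> W"
    proof (rule n)
      show "finite (sym_diff a g)" using fin[OF aK] fin[OF g] by blast
      show "\<forall>s. length s < n \<longrightarrow> parity (sym_diff a g) s = parity {} s"
        using a(2) fin[OF aK] fin[OF g] by (auto simp: parity_sym_diff)
    qed
    ultimately have U: "sym_diff a g \<in> U" using W(3) by blast
    have mult: "b \<otimes>\<^bsub>(B_group cantor)\<lparr>carrier := K\<rparr>\<^esub> c = sym_diff b c" for b c by simp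
    have "g = sym_diff a (sym_diff a g)" by blast
    then have "g \<in> {a \<otimes>\<^bsub>(B_group cantor)\<lparr>carrier := K\<rparr>\<^esub> sym_diff a g}"
      unfolding mult singleton_iff .
    then have "g \<in> a <#\<^bsub>(B_group cantor)\<lparr>carrier := K\<rparr>\<^esub> U"
      unfolding l_coset_def using U by (rule UN_I[rotated])
    then show ?thesis using a(1) by (rule UN_I[rotated])
  qed
  then show "\<exists>F. finite F \<and> F \<subseteq> carrier ((B_group cantor)\<lparr>carrier := K\<rparr>) \<and>
      carrier ((B_group cantor)\<lparr>carrier := K\<rparr>)
        \<subseteq> (\<Union>a\<in>F. a <#\<^bsub>(B_group cantor)\<lparr>carrier := K\<rparr>\<^esub> U)"
    using F by (intro exI[of _ F]) auto
qed

section \<open>The retraction\<close>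

lemma cyl_snoc:
  shows "cyl s = cyl (s @ [b]) \<union> cyl (s @ [\<not> b])" "cyl (s @ [b]) \<inter> cyl (s @ [\<not> b]) = {}"
  by (auto simp: mem_cyl_iff)

lemma parity_split:
  assumes "finite g"
  shows "parity g s \<longleftrightarrow> parity g (s @ [b]) \<noteq> parity g (s @ [\<not> b])"
proof -
  have "g \<inter> cyl s = (g \<inter> cyl (s @ [b])) \<union> (g \<inter> cyl (s @ [\<not> b]))"
    using cyl_snoc(1)[of s b] by blast
  then have "card (g \<inter> cyl s) = card (g \<inter> cyl (s @ [b])) + card (g \<inter> cyl (s @ [\<not> b]))"
    using assms cyl_snoc(2)[of s b] by (subst card_Un_disjoint[symmetric]) auto
  then show ?thesis by (auto simp: parity_def)
qed

text \<open>At the first differing digit the two points enter opposite halves of a common odd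
  cylinder, and both halves would be odd. The bounded form yields uniqueness of the root as well as
  its continuity.\<close>

lemma odd_branch_unique:
  assumes "finite g"
    and "\<And>k. k \<le> n \<Longrightarrow> parity g (pre k x)" "\<And>k. k \<le> n \<Longrightarrow> parity g (pre k y)"
  shows "pre n x = pre n y"
  using assms(2,3)
proof (induction n)
  case (Suc n)
  then have IH: "pre n x = pre n y" by simp
  have "x n = y n"
  proof (rule ccontr)
    assume "x n \<noteq> y n"
    then have "pre (Suc n) y = pre n x @ [\<not> x n]" using IH by auto
    moreover have "pre (Suc n) x = pre n x @ [x n]" by simp
    moreover have "parity g (pre n x)" "parity g (pre (Suc n) x)" "parity g (pre (Suc n) y)"
      using Suc.prems(1)[of n] Suc.prems(1)[of "Suc n"] Suc.prems(2)[of "Suc n"] by simp_all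
    ultimately show False using parity_split[OF assms(1), of "pre n x" "x n"] by metis
  qed
  then show ?case using IH by simp
qed simp

text \<open>An odd cylinder meets \<open>g\<close>, so the odd half at the next level contains a
  point of \<open>g\<close>. That point replaces the previous witness, whose earlier digits it
  shares.\<close>

lemma odd_branch_upto:
  assumes "finite g" "odd (card g)"
  shows "\<exists>x\<in>g. \<forall>k\<le>n. parity g (pre k x)"
proof (induction n)
  case 0
  have "g \<noteq> {}" using assms by auto
  then show ?case using assms(2) by (auto simp: parity_Nil)
next
  case (Suc n)
  then obtain x where x: "x \<in> g" "\<And>k. k \<le> n \<Longrightarrow> parity g (pre k x)" by blast
  obtain b where b: "parity g (pre n x @ [b])"
    using x(2)[of n] parity_split[OF assms(1), of "pre n x" True] by auto
  then have "g \<inter> cyl (pre n x @ [b]) \<noteq> {}" unfolding parity_def by (metis card.empty even_zero)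
  then obtain y where y: "y \<in> g" "y \<in> cyl (pre n x @ [b])" by blast
  then have eq: "pre (Suc n) y = pre n x @ [b]" by (simp add: mem_cyl_iff)
  have "parity g (pre k y)" if "k \<le> Suc n" for k
  proof (cases "k = Suc n")
    case True
    then show ?thesis using eq b by (simp only:)
  next
    case False
    then have "k \<le> n" using that by simp
    moreover have "pre n y = pre n x" using eq by simp
    ultimately have "pre k y = pre k x" by auto
    then show ?thesis using x(2)[OF \<open>k \<le> n\<close>] by (simp only:)
  qed
  then show ?case using y(1) by blast
qed

text \<open>The witness for a level beyond the isolating levels of all points of \<open>g\<close>
  works for every level: deeper cylinders around it meet \<open>g\<close> in that point
  alone.\<close>

lemma odd_branch_exists:
  assumes "finite g" "odd (card g)"
  shows "\<exists>x\<in>g. \<forall>k. parity g (pre k x)"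
proof -
  have "\<forall>x. \<exists>n. g \<inter> cyl (pre n x) \<subseteq> {x}" using isolating_level[OF assms(1)] by metis
  then obtain N where N: "\<And>x. g \<inter> cyl (pre (N x) x) \<subseteq> {x}" by metis
  define n where "n = Max (insert 0 (N ` g))"
  obtain x where x: "x \<in> g" "\<And>k. k \<le> n \<Longrightarrow> parity g (pre k x)"
    using odd_branch_upto[OF assms, of n] by blast
  have "N x \<le> n" unfolding n_def using assms(1) x(1) by (intro Max_ge) auto
  have "parity g (pre k x)" for k
  proof (cases "k \<le> n")
    case False
    have "g \<inter> cyl (pre k x) \<subseteq> g \<inter> cyl (pre (N x) x)"
      using False \<open>N x \<le> n\<close> by (auto simp: mem_cyl_pre)
    then have "g \<inter> cyl (pre k x) = {x}" using N[of x] x(1) by (auto simp: mem_cyl_pre)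
    then show ?thesis by (simp add: parity_def)
  qed (rule x(2))
  then show ?thesis using x(1) by blast
qed

text \<open>The retraction of the theorem. The description is justified for finite \<open>g\<close>
  of odd cardinality.\<close>

definition odd_root :: "(nat \<Rightarrow> bool) set \<Rightarrow> nat \<Rightarrow> bool" where
  "odd_root g = (THE x. \<forall>k. parity g (pre k x))"

lemma odd_root_eqI:
  assumes "finite g" "\<And>k. parity g (pre k x)"
  shows "odd_root g = x"
  unfolding odd_root_def
proof (rule the_equality)
  fix y assume y: "\<forall>k. parity g (pre k y)"
  show "y = x"
  proof
    fix i
    have "pre (Suc i) y = pre (Suc i) x"
      by (rule odd_branch_unique[OF assms(1)]) (use y assms(2) in auto)
    then show "y i = x i" by simp
  qed
qed (use assms(2) in blast)

lemma
  assumes "finite g" "odd (card g)"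
  shows odd_root_in: "odd_root g \<in> g" and parity_odd_root: "parity g (pre k (odd_root g))"
proof -
  obtain x where "x \<in> g" "\<And>k. parity g (pre k x)" using odd_branch_exists[OF assms] by blast
  then show "odd_root g \<in> g" "parity g (pre k (odd_root g))" using odd_root_eqI[OF assms(1)] by auto
qed

lemma odd_root_singleton [simp]: "odd_root {x} = x"
  by (rule odd_root_eqI) (auto simp: mem_cyl_pre)

text \<open>The first \<open>n\<close> digits form a word of length \<open>n\<close>, so parities up
  to and including length \<open>n\<close> are required; hence \<open>Suc n\<close> in the strict
  bound.\<close>

lemma odd_root_local:
  assumes "finite g" "odd (card g)" "finite h" "odd (card h)"
    and "\<forall>s. length s < Suc n \<longrightarrow> parity h s = parity g s"
  shows "\<forall>i<n. odd_root h i = odd_root g i"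
proof -
  have "pre n (odd_root h) = pre n (odd_root g)"
  proof (rule odd_branch_unique[OF assms(1)])
    fix k assume "k \<le> n"
    then show "parity g (pre k (odd_root h))" "parity g (pre k (odd_root g))"
      using parity_odd_root[OF assms(1,2), of k] parity_odd_root[OF assms(3,4), of k] assms(5) by auto
  qed
  then show ?thesis by simp
qed

text \<open>Up to level \<open>n\<close> the points \<open>x\<close> and \<open>odd_root g\<close>
  lie in the same cylinders, so the exchange changes no parity; beyond it, the cylinders around
  \<open>x\<close> contain no other point of \<open>h\<close>. Writing the exchange with
  \<open>sym_diff\<close> covers \<open>x = odd_root g\<close>, where \<open>h = g\<close>.\<close>

lemma odd_root_exchange:
  assumes "finite g" "odd (card g)" "g \<inter> cyl (pre n (odd_root g)) \<subseteq> {odd_root g}"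
    and x: "\<forall>i<n. x i = odd_root g i"
  defines "h \<equiv> sym_diff g (sym_diff {odd_root g} {x})"
  shows "finite h" "odd (card h)" "odd_root h = x" "\<forall>s. length s \<le> n \<longrightarrow> parity h s = parity g s"
proof -
  show fin: "finite h" using assms(1) by (simp add: h_def)
  have par: "parity h s \<longleftrightarrow> (parity g s \<noteq> ((odd_root g \<in> cyl s) \<noteq> (x \<in> cyl s)))" for s
    using assms(1) by (simp add: h_def parity_sym_diff)
  have "x \<in> cyl s \<longleftrightarrow> odd_root g \<in> cyl s" if "length s \<le> n" for s
    using x that by (auto simp: cyl_def)
  then show low: "\<forall>s. length s \<le> n \<longrightarrow> parity h s = parity g s"
    by (simp add: par)
  then show "odd (card h)" using assms(2) by (simp flip: parity_Nil)
  have "parity h (pre k x)" for k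
  proof (cases "k \<le> n")
    case True
    then have "pre k x = pre k (odd_root g)" using x by auto
    moreover have "parity h (pre k (odd_root g))"
      using low True parity_odd_root[OF assms(1,2), of k] by simp
    ultimately show ?thesis by (simp only:)
  next
    case False
    have sub: "cyl (pre k x) \<subseteq> cyl (pre n (odd_root g))" using False x by (auto simp: mem_cyl_pre)
    have "h \<inter> cyl (pre k x) = {x}"
      using assms(3) sub odd_root_in[OF assms(1,2)] unfolding h_def by (auto simp: mem_cyl_pre)
    then show ?thesis by (simp add: parity_def)
  qed
  then show "odd_root h = x" by (rule odd_root_eqI[OF fin])
qed

section \<open>Continuity and openness of the retraction\<close>

lemma mem_B_parity_on_1:
  "g \<in> B_parity_on (Suc 0) cantor X \<longleftrightarrow> finite g \<and> odd (card g) \<and> g \<subseteq> X"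
  by (auto simp: B_parity_on_def B_parity_def odd_iff_mod_2_eq_one)

lemma continuous_map_odd_root:
  "continuous_map (subtopology (Bz cantor) (B_parity_on 1 cantor X)) (subtopology cantor X) odd_root"
    (is "continuous_map ?S _ _")
proof -
  have "continuous_map ?S cantor odd_root"
    unfolding continuous_map
  proof (intro conjI allI impI)
    fix U assume U: "openin cantor U"
    let ?V = "{g. finite g \<and> odd (card g) \<and> odd_root g \<in> U}"
    have "openin (Bz cantor) ?V"
      unfolding openin_Bz_cantor
    proof (intro conjI ballI)
      fix g assume g: "g \<in> ?V"
      then have "odd_root g \<in> U" by simp
      obtain n where n: "\<And>y. (\<forall>i<n. y i = odd_root g i) \<Longrightarrow> y \<in> U"
        using openin_cantorE[OF U \<open>odd_root g \<in> U\<close>] by metis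
      have "h \<in> ?V" if h: "finite h" "\<forall>s. length s < Suc n \<longrightarrow> parity h s = parity g s" for h
      proof -
        \<comment> \<open>Level \<open>Suc n\<close> always includes the empty word, whose parity is
          that of the cardinality.\<close>
        have "odd (card h)" using h(2) g by (simp flip: parity_Nil)
        moreover have "odd_root h \<in> U" by (rule n, rule odd_root_local) (use g h \<open>odd (card h)\<close> in auto)
        ultimately show ?thesis using h(1) by simp
      qed
      then show "\<exists>n. \<forall>h. finite h \<and> (\<forall>s. length s < n \<longrightarrow> parity h s = parity g s) \<longrightarrow> h \<in> ?V"
        by (intro exI[of _ "Suc n"]) simp
    qed auto
    moreover have "{g \<in> topspace ?S. odd_root g \<in> U} = ?V \<inter> B_parity_on 1 cantor X"
      by (auto simp: mem_B_parity_on_1)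
    ultimately show "openin ?S {g \<in> topspace ?S. odd_root g \<in> U}"
      unfolding openin_subtopology by blast
  qed auto
  moreover have "odd_root g \<in> X" if "g \<in> topspace ?S" for g
    using that odd_root_in[of g] by (auto simp: mem_B_parity_on_1)
  ultimately show ?thesis by (auto simp: continuous_map_in_subtopology)
qed

lemma continuous_map_singleton:
  "continuous_map (subtopology cantor X) (subtopology (Bz cantor) (B_parity_on 1 cantor X)) (\<lambda>x. {x})"
proof -
  have "continuous_map cantor (Bz cantor) (\<lambda>x. {x})"
    unfolding continuous_map
  proof (intro conjI allI impI)
    fix U assume U: "openin (Bz cantor) U"
    show "openin cantor {x \<in> topspace cantor. {x} \<in> U}"
      unfolding openin_cantor
    proof
      fix x assume "x \<in> {x \<in> topspace cantor. {x} \<in> U}"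
      then have x: "{x} \<in> U" by simp
      obtain n
        where n: "\<And>h. finite h \<Longrightarrow> \<forall>s. length s < n \<longrightarrow> parity h s = parity {x} s \<Longrightarrow> h \<in> U"
        using openin_Bz_cantorE[OF U x] by metis
      have "{y} \<in> U" if "\<forall>i<n. y i = x i" for y
      proof (rule n)
        show "\<forall>s. length s < n \<longrightarrow> parity {y} s = parity {x} s"
          using that by (auto simp: cyl_def)
      qed simp
      then show "\<exists>n. \<forall>y. (\<forall>i<n. y i = x i) \<longrightarrow> y \<in> {x \<in> topspace cantor. {x} \<in> U}"
        by (intro exI[of _ n]) simp
    qed
  qed auto
  then show ?thesis
    by (auto simp: continuous_map_in_subtopology mem_B_parity_on_1
        intro: continuous_map_from_subtopology)
qed

text \<open>Every \<open>x\<close> in \<open>X\<close> close to the root of \<open>g\<close> is the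
  root of the set obtained from \<open>g\<close> by exchanging the root for \<open>x\<close>. That
  set stays in \<open>X\<close> and, by closeness, in the given open set.\<close>

lemma open_map_odd_root:
  "open_map (subtopology (Bz cantor) (B_parity_on 1 cantor X)) (subtopology cantor X) odd_root"
  unfolding open_map_def
proof (intro allI impI)
  fix V assume "openin (subtopology (Bz cantor) (B_parity_on 1 cantor X)) V"
  then obtain U where U: "openin (Bz cantor) U" "V = U \<inter> B_parity_on 1 cantor X"
    unfolding openin_subtopology by blast
  show "openin (subtopology cantor X) (odd_root ` V)"
  proof (subst openin_subopen, rule ballI)
    fix z assume "z \<in> odd_root ` V"
    then obtain g where g: "g \<in> U" "finite g" "odd (card g)" "g \<subseteq> X" and z: "z = odd_root g"
      unfolding U(2) by (auto simp: mem_B_parity_on_1)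
    obtain n
      where n: "\<And>h. finite h \<Longrightarrow> \<forall>s. length s < n \<longrightarrow> parity h s = parity g s \<Longrightarrow> h \<in> U"
      using openin_Bz_cantorE[OF U(1) g(1)] by metis
    obtain m where m: "g \<inter> cyl (pre m z) \<subseteq> {z}" using isolating_level[OF g(2)] .
    \<comment> \<open>Level \<open>m\<close> isolates the root within \<open>g\<close>; level
      \<open>n\<close> keeps the exchanged set in \<open>U\<close>.\<close>
    let ?k = "max m n"
    let ?W = "cyl (pre ?k z) \<inter> X"
    have iso: "g \<inter> cyl (pre ?k (odd_root g)) \<subseteq> {odd_root g}"
      using m unfolding z by (auto simp: mem_cyl_pre)
    have "x \<in> odd_root ` V" if "x \<in> ?W" for x
    proof -
      let ?h = "sym_diff g (sym_diff {odd_root g} {x})"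
      have x: "x \<in> X" "\<forall>i<?k. x i = odd_root g i" using that by (auto simp: mem_cyl_pre z)
      note h = odd_root_exchange[OF g(2,3) iso x(2)]
      have "?h \<in> U" by (rule n[OF h(1)]) (use h(4) in simp)
      moreover have "?h \<subseteq> X" using g(4) x(1) odd_root_in[OF g(2,3)] by blast
      ultimately have "?h \<in> V" unfolding U(2) using h(1,2) by (simp add: mem_B_parity_on_1)
      then show ?thesis using h(3) by (metis imageI)
    qed
    moreover have "openin (subtopology cantor X) ?W"
      using openin_cyl unfolding openin_subtopology by blast
    moreover have "z \<in> ?W" using odd_root_in[OF g(2,3)] g(4) by (auto simp: z mem_cyl_pre)
    ultimately show "\<exists>T. openin (subtopology cantor X) T \<and> z \<in> T \<and> T \<subseteq> odd_root ` V"
      by (intro exI[of _ ?W]) blast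
  qed
qed

lemma open_retraction_maps_odd_root:
  "open_retraction_maps (subtopology (Bz cantor) (B_parity_on 1 cantor X)) (subtopology cantor X)
    odd_root (\<lambda>x. {x})"
  unfolding open_retraction_maps_def retraction_maps_def
  using continuous_map_odd_root continuous_map_singleton open_map_odd_root by simp

text \<open>Transports a retraction along a homeomorphism: the new one goes back by the inverse
  \<open>h'\<close>, applies \<open>r\<close>, and re-embeds by \<open>h \<circ> e\<close>. The
  embedding claim holds because a section is an embedding.\<close>

lemma open_continuous_retract_homeomorphic:
  assumes ret: "open_retraction_maps S Y r e" and hom: "homeomorphic_map S T h"
  shows "embedding_map Y T (h \<circ> e)" "open_continuous_retract ((h \<circ> e) ` topspace Y) T"
proof -
  have r: "continuous_map S Y r" "open_map S Y r" "retraction_maps S Y r e"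
    and re: "\<And>y. y \<in> topspace Y \<Longrightarrow> r (e y) = y"
    and ey: "\<And>y. y \<in> topspace Y \<Longrightarrow> e y \<in> topspace S"
    using ret by (auto simp: open_retraction_maps_def retraction_maps_def continuous_map_def)
  have "embedding_map Y S e"
    using r(3) section_imp_embedding_map section_map_def by blast
  then show emb: "embedding_map Y T (h \<circ> e)"
    using hom by (metis embedding_map_compose homeomorphic_map_def embedding_map_def 
       homeomorphic_imp_surjective_map subtopology_topspace)
  obtain h' where h': "homeomorphic_maps S T h h'"
    using hom homeomorphic_map_maps by blast
  then have hom': "homeomorphic_map T S h'" and h'h: "\<And>s. s \<in> topspace S \<Longrightarrow> h' (h s) = s"
    by (auto simp: homeomorphic_maps_map)
  let ?A = "(h \<circ> e) ` topspace Y"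
  have A: "?A \<subseteq> topspace T" using ey homeomorphic_imp_surjective_map[OF hom] by auto
  have e': "homeomorphic_map Y (subtopology T ?A) (h \<circ> e)"
    using emb by (simp add: embedding_map_def)
  let ?r = "(h \<circ> e) \<circ> (r \<circ> h')"
  have "continuous_map T (subtopology T ?A) ?r"
    using homeomorphic_imp_continuous_map[OF hom'] r(1) homeomorphic_imp_continuous_map[OF e']
    by (blast intro: continuous_map_compose)
  moreover have "open_map T (subtopology T ?A) ?r"
    using homeomorphic_imp_open_map[OF hom'] r(2) homeomorphic_imp_open_map[OF e']
    by (blast intro: open_map_compose)
  moreover have "\<forall>a\<in>?A. ?r a = a" using h'h ey re by auto
  ultimately show "open_continuous_retract ?A T"
    using A by (auto simp: open_continuous_retract_def)
qed

section \<open>The even subgroups and translation by a point\<close>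

lemma mem_B_parity_on_0:
  "g \<in> B_parity_on 0 cantor X \<longleftrightarrow> finite g \<and> even (card g) \<and> g \<subseteq> X"
  by (auto simp: B_parity_on_def B_parity_def even_iff_mod_2_eq_zero)

lemma B_parity_on_UNIV [simp]: "B_parity_on i cantor UNIV = B_parity i cantor"
  by (simp add: B_parity_on_def)

lemma subgroup_B_parity_on_0: "subgroup (B_parity_on 0 cantor X) (B_group cantor)"
proof (rule group.subgroupI[OF group_B])
  show "B_parity_on 0 cantor X \<noteq> {}"
    using mem_B_parity_on_0[of "{}"] by auto
  fix g assume g: "g \<in> B_parity_on 0 cantor X"
  then show "inv\<^bsub>B_group cantor\<^esub> g \<in> B_parity_on 0 cantor X"
    by (simp add: inv_B mem_B_parity_on_0)
  fix h assume "h \<in> B_parity_on 0 cantor X"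
  then show "g \<otimes>\<^bsub>B_group cantor\<^esub> h \<in> B_parity_on 0 cantor X"
    using g by (auto simp: mem_B_parity_on_0 even_card_sym_diff)
qed (auto simp: mem_B_parity_on_0)

text \<open>Translation by \<open>{y}\<close> changes each parity by a fixed amount, hence is
  continuous. It is its own inverse, swaps odd and even cardinality, and preserves inclusion in
  \<open>X\<close> as \<open>y \<in> X\<close>.\<close>

lemma homeomorphic_map_translation:
  assumes "y \<in> X"
  shows "homeomorphic_map (subtopology (Bz cantor) (B_parity_on 1 cantor X))
    (subtopology (Bz cantor) (B_parity_on 0 cantor X)) (\<lambda>g. sym_diff g {y})"
proof -
  let ?h = "\<lambda>g. sym_diff g {y}"
  have cont: "continuous_map (Bz cantor) (Bz cantor) ?h"
    unfolding continuous_map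
  proof (intro conjI allI impI)
    fix U assume U: "openin (Bz cantor) U"
    show "openin (Bz cantor) {g \<in> topspace (Bz cantor). ?h g \<in> U}"
      unfolding openin_Bz_cantor
    proof (intro conjI ballI)
      fix g assume "g \<in> {g \<in> topspace (Bz cantor). ?h g \<in> U}"
      then have g: "finite g" "?h g \<in> U" by auto
      obtain n
        where n: "\<And>k. finite k \<Longrightarrow> \<forall>s. length s < n \<longrightarrow> parity k s = parity (?h g) s \<Longrightarrow> k \<in> U"
        using openin_Bz_cantorE[OF U g(2)] by metis
      have "?h k \<in> U" if "finite k" "\<forall>s. length s < n \<longrightarrow> parity k s = parity g s" for k
        by (rule n) (use that g(1) in \<open>auto simp: parity_sym_diff\<close>)
      then show "\<exists>n. \<forall>k. finite k \<and> (\<forall>s. length s < n \<longrightarrow> parity k s = parity g s) \<longrightarrow>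
          k \<in> {g \<in> topspace (Bz cantor). ?h g \<in> U}"
        by (intro exI[of _ n]) auto
    qed auto
  qed auto
  have inv: "?h (?h g) = g" for g by blast
  have h10: "?h g \<in> B_parity_on 0 cantor X" if "g \<in> B_parity_on 1 cantor X" for g
    using that assms even_card_sym_diff[of g "{y}"]
    by (auto simp: mem_B_parity_on_0 mem_B_parity_on_1)
  have h01: "?h g \<in> B_parity_on 1 cantor X" if "g \<in> B_parity_on 0 cantor X" for g
    using that assms even_card_sym_diff[of g "{y}"]
    by (auto simp: mem_B_parity_on_0 mem_B_parity_on_1)
  have "homeomorphic_maps (subtopology (Bz cantor) (B_parity_on 1 cantor X))
      (subtopology (Bz cantor) (B_parity_on 0 cantor X)) ?h ?h"
    unfolding homeomorphic_maps_def continuous_map_in_subtopology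
    using h10 h01 inv by (auto intro: continuous_map_from_subtopology[OF cont])
  then show ?thesis using homeomorphic_map_maps by blast
qed

theorem theorem2:
  shows
    "(\<exists>r. open_retraction_maps (subtopology (Bz cantor) (B_parity 1 cantor)) cantor r (\<lambda>x. {x}) \<and>
        (\<forall>X. X \<subseteq> topspace cantor \<longrightarrow>
           open_retraction_maps (subtopology (Bz cantor) (B_parity_on 1 cantor X))
             (subtopology cantor X) r (\<lambda>x. {x})))
     \<and> openin (Bz cantor) (B_parity 1 cantor) \<and> closedin (Bz cantor) (B_parity 1 cantor)
     \<and> precompact_group (B_group cantor) (Bz cantor)
     \<and> separable_space (Bz cantor)
     \<and> metrizable_space (Bz cantor)
     \<and> Bz cantor dim_le 0
     \<and> (\<forall>X y. X \<subseteq> topspace cantor \<and> y \<in> X \<longrightarrow>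
          (let h = (\<lambda>g. g \<otimes>\<^bsub>B_group cantor\<^esub> {y});
               G = (B_group cantor)\<lparr>carrier := B_parity_on 0 cantor X\<rparr>;
               T = subtopology (Bz cantor) (B_parity_on 0 cantor X)
           in homeomorphic_map (subtopology (Bz cantor) (B_parity 1 cantor))
                (subtopology (Bz cantor) (B_parity 0 cantor)) h
            \<and> h ` B_parity_on 1 cantor X = B_parity_on 0 cantor X
            \<and> precompact_group G T
            \<and> boolean_group G
            \<and> separable_space T
            \<and> metrizable_space T
            \<and> T dim_le 0
            \<and> embedding_map (subtopology cantor X) T (\<lambda>x. h {x})
            \<and> open_continuous_retract ((\<lambda>x. h {x}) ` X) T))"
proof (intro conjI allI impI)
  show "\<exists>r. open_retraction_maps (subtopology (Bz cantor) (B_parity 1 cantor)) cantor r (\<lambda>x. {x}) \<and>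
      (\<forall>X. X \<subseteq> topspace cantor \<longrightarrow>
         open_retraction_maps (subtopology (Bz cantor) (B_parity_on 1 cantor X))
           (subtopology cantor X) r (\<lambda>x. {x}))"
    using open_retraction_maps_odd_root[of UNIV] open_retraction_maps_odd_root
    by (intro exI[of _ odd_root]) simp
  \<comment> \<open>Oddness is the parity at the empty word alone, so level \<open>Suc 0\<close>
    shows that the odd part is clopen.\<close>
  have "g \<in> B_parity 1 cantor \<longleftrightarrow> finite g \<and> parity g []" for g
    using mem_B_parity_on_1[of g UNIV] by (simp add: parity_Nil)
  then show "openin (Bz cantor) (B_parity 1 cantor)" "closedin (Bz cantor) (B_parity 1 cantor)"
    by (intro clopen_Bz_cantor[of _ "Suc 0"]; auto)+
  show "precompact_group (B_group cantor) (Bz cantor)"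
    using precompact_subgroup_Bz_cantor[OF group.subgroup_self[OF group_B]]
      subtopology_topspace[of "Bz cantor"] by (simp add: B_group_def)
  show "separable_space (Bz cantor)"
    by (rule second_countable_imp_separable_space[OF second_countable_Bz_cantor])
  show "metrizable_space (Bz cantor)" by (rule metrizable_Bz_cantor)
  show "Bz cantor dim_le 0" by (rule dim_Bz_cantor)
next
  fix X y assume "X \<subseteq> topspace cantor \<and> y \<in> X"
  then have y: "y \<in> X" by blast
  let ?h = "\<lambda>g. sym_diff g {y}"
  let ?G = "(B_group cantor)\<lparr>carrier := B_parity_on 0 cantor X\<rparr>"
  let ?S = "subtopology (Bz cantor) (B_parity_on 1 cantor X)"
  let ?T = "subtopology (Bz cantor) (B_parity_on 0 cantor X)"
  have hom: "homeomorphic_map ?S ?T ?h" by (rule homeomorphic_map_translation[OF y])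
  have top: "topspace ?S = B_parity_on 1 cantor X" "topspace ?T = B_parity_on 0 cantor X"
    by (auto simp: mem_B_parity_on_0 mem_B_parity_on_1)
  have img: "?h ` B_parity_on 1 cantor X = B_parity_on 0 cantor X"
    using homeomorphic_imp_surjective_map[OF hom] unfolding top .
  have hom': "homeomorphic_map (subtopology (Bz cantor) (B_parity 1 cantor))
      (subtopology (Bz cantor) (B_parity 0 cantor)) ?h"
    using homeomorphic_map_translation[of y UNIV] by simp
  have bool: "boolean_group ?G"
    using group.subgroup_imp_group[OF group_B subgroup_B_parity_on_0]
    by (simp add: boolean_group_def)
  have sep: "separable_space ?T"
    by (intro second_countable_imp_separable_space second_countable_subtopology
        second_countable_Bz_cantor)
  have met: "metrizable_space ?T"
    by (rule metrizable_space_subtopology[OF metrizable_Bz_cantor])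
  have dim: "?T dim_le 0" by (rule dimension_le_subtopology[OF dim_Bz_cantor])
  note ret = open_continuous_retract_homeomorphic[OF open_retraction_maps_odd_root hom, unfolded o_def]
  show "let h = (\<lambda>g. g \<otimes>\<^bsub>B_group cantor\<^esub> {y}); G = ?G; T = ?T
      in homeomorphic_map (subtopology (Bz cantor) (B_parity 1 cantor))
           (subtopology (Bz cantor) (B_parity 0 cantor)) h
       \<and> h ` B_parity_on 1 cantor X = B_parity_on 0 cantor X
       \<and> precompact_group G T \<and> boolean_group G \<and> separable_space T \<and> metrizable_space T
       \<and> T dim_le 0 \<and> embedding_map (subtopology cantor X) T (\<lambda>x. h {x})
       \<and> open_continuous_retract ((\<lambda>x. h {x}) ` X) T"
    unfolding Let_def mult_B
    using hom' img precompact_subgroup_Bz_cantor[OF subgroup_B_parity_on_0] bool sep met dim ret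
    by (simp only: simp_thms topspace_subtopology topspace_cantor Int_UNIV_left)
qed

end
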